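(* Suppose Hedetniemi's conjecture is true, i.e. $\chi(G\times H)=\min(\chi(G),\chi(H))$ for all finite graphs $G,H$. Then for any $\mathbb{Z}_2$-spaces $X,Y$ and any integer $d\ge 0$: if there is a $\mathbb{Z}_2$-map $X\times Y\to\mathcal{S}^d$, then there is a $\mathbb{Z}_2$-map $X\to\mathcal{S}^d$ or a $\mathbb{Z}_2$-map $Y\to\mathcal{S}^d$.
   Context: Graphs are finite with a symmetric adjacency relation; $\chi(G)$ is the least $n$ such that $G$ has a homomorphism (adjacency-preserving vertex map) to the complete graph $K_n$. The tensor product $G\times H$ has vertex set $V(G)\times V(H)$, with $(g,h)$ adjacent to $(g',h')$ iff $g\sim g'$ in $G$ and $h\sim h'$ in $H$. A $\mathbb{Z}_2$-space is a topological space with a continuous involution; throughout, $\mathbb{Z}_2$-spaces are (up to $\mathbb{Z}_2$-homotopy equivalence) geometric realizations of finite simplicial complexes with a simplicial involution. A $\mathbb{Z}_2$-map is a continuous map commuting with the involutions. $X\times Y$ carries the involution $(x,y)\mapsto(\nu_X(x),\nu_Y(y))$. $\mathcal{S}^d$ is the unit sphere in $\mathbb{R}^{d+1}$ with the antipodal involution $x\mapsto -x$. *)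

theory Defs
  imports "HOL-Analysis.Analysis" "HOL-Library.Extended_Nat"
begin

section \<open>Graphs\<close>

record 'a ugraph =
  verts :: "'a set"
  adj :: "('a \<times> 'a) set"

text \<open>Loops are not excluded.\<close>

definition finite_graph :: "'a ugraph \<Rightarrow> bool" where
  "finite_graph G \<longleftrightarrow>
     finite (verts G) \<and> adj G \<subseteq> verts G \<times> verts G \<and> sym (adj G)"

definition graph_hom :: "'a ugraph \<Rightarrow> 'b ugraph \<Rightarrow> ('a \<Rightarrow> 'b) \<Rightarrow> bool" where
  "graph_hom G H f \<longleftrightarrow>
     f ` verts G \<subseteq> verts H \<and> (\<forall>(u, v) \<in> adj G. (f u, f v) \<in> adj H)"

definition complete_graph :: "nat \<Rightarrow> nat ugraph" where
  "complete_graph n =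
     \<lparr>verts = {..<n}, adj = {(i, j). i < n \<and> j < n \<and> i \<noteq> j}\<rparr>"

text \<open>The infimum in \<^typ>\<open>enat\<close> is the least such \<open>n\<close>; it is \<open>\<infinity>\<close> when there
  is none, which for a finite graph happens exactly when the graph has a loop.\<close>

definition chromatic_number :: "'a ugraph \<Rightarrow> enat" where
  "chromatic_number G = (INF n \<in> {n. \<exists>f. graph_hom G (complete_graph n) f}. enat n)"

definition tensor_product :: "'a ugraph \<Rightarrow> 'b ugraph \<Rightarrow> ('a \<times> 'b) ugraph" where
  "tensor_product G H =
     \<lparr>verts = verts G \<times> verts H,
      adj = {((g, h), (g', h')). (g, g') \<in> adj G \<and> (h, h') \<in> adj H}\<rparr>"

text \<open>Every finite graph is isomorphic to one whose vertices are natural numbers, so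
  quantifying over graphs on subsets of \<^typ>\<open>nat\<close> covers all finite graphs.\<close>

definition hedetniemi_conjecture :: bool where
  "hedetniemi_conjecture \<longleftrightarrow>
     (\<forall>(G :: nat ugraph) (H :: nat ugraph). finite_graph G \<longrightarrow> finite_graph H \<longrightarrow>
        chromatic_number (tensor_product G H) = min (chromatic_number G) (chromatic_number H))"

section \<open>Spaces with involution\<close>

definition continuous_involution :: "'a topology \<Rightarrow> ('a \<Rightarrow> 'a) \<Rightarrow> bool" where
  "continuous_involution X \<nu> \<longleftrightarrow>
     continuous_map X X \<nu> \<and> (\<forall>x \<in> topspace X. \<nu> (\<nu> x) = x)"

definition equivariant ::
    "'a topology \<Rightarrow> ('a \<Rightarrow> 'a) \<Rightarrow> ('b \<Rightarrow> 'b) \<Rightarrow> ('a \<Rightarrow> 'b) \<Rightarrow> bool" where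
  "equivariant X \<nu> \<mu> f \<longleftrightarrow> (\<forall>x \<in> topspace X. f (\<nu> x) = \<mu> (f x))"

definition Z2_map ::
    "'a topology \<Rightarrow> ('a \<Rightarrow> 'a) \<Rightarrow> 'b topology \<Rightarrow> ('b \<Rightarrow> 'b) \<Rightarrow> ('a \<Rightarrow> 'b) \<Rightarrow> bool" where
  "Z2_map X \<nu> Y \<mu> f \<longleftrightarrow> continuous_map X Y f \<and> equivariant X \<nu> \<mu> f"

definition Z2_homotopy_equivalent ::
    "'a topology \<Rightarrow> ('a \<Rightarrow> 'a) \<Rightarrow> 'b topology \<Rightarrow> ('b \<Rightarrow> 'b) \<Rightarrow> bool" where
  "Z2_homotopy_equivalent X \<nu> Y \<mu> \<longleftrightarrow>
     (\<exists>f g. Z2_map X \<nu> Y \<mu> f \<and> Z2_map Y \<mu> X \<nu> g \<and>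
            homotopic_with (equivariant X \<nu> \<nu>) X X (g \<circ> f) id \<and>
            homotopic_with (equivariant Y \<mu> \<mu>) Y Y (f \<circ> g) id)"

definition finite_complex :: "'v set set \<Rightarrow> bool" where
  "finite_complex K \<longleftrightarrow>
     finite K \<and> (\<forall>A \<in> K. finite A \<and> A \<noteq> {}) \<and>
     (\<forall>A \<in> K. \<forall>B. B \<subseteq> A \<and> B \<noteq> {} \<longrightarrow> B \<in> K)"

definition simplicial_involution :: "'v set set \<Rightarrow> ('v \<Rightarrow> 'v) \<Rightarrow> bool" where
  "simplicial_involution K \<sigma> \<longleftrightarrow>
     (\<forall>A \<in> K. \<sigma> ` A \<in> K) \<and> (\<forall>v \<in> \<Union>K. \<sigma> (\<sigma> v) = v)"

text \<open>Points are given by their barycentric coordinates. For a finite complex the topology of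
  coordinatewise convergence is the usual one.\<close>

definition geometric_realization :: "'v set set \<Rightarrow> ('v \<Rightarrow> real) topology" where
  "geometric_realization K =
     subtopology (powertop_real UNIV)
       {t. (\<forall>v. 0 \<le> t v) \<and> {v. t v \<noteq> 0} \<in> K \<and> (\<Sum>v \<in> \<Union>K. t v) = 1}"

text \<open>The affine extension of a vertex map: the weight at \<open>w\<close> is the total weight of the
  vertices sent to \<open>w\<close>.\<close>

definition realization_map :: "'v set set \<Rightarrow> ('v \<Rightarrow> 'v) \<Rightarrow> ('v \<Rightarrow> real) \<Rightarrow> 'v \<Rightarrow> real" where
  "realization_map K \<sigma> t = (\<lambda>w. \<Sum>v \<in> {v \<in> \<Union>K. \<sigma> v = w}. t v)"

text \<open>The involution may have fixed points. Complexes on subsets of \<^typ>\<open>nat\<close> cover all finite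
  complexes up to isomorphism.\<close>

definition Z2_space :: "'a topology \<Rightarrow> ('a \<Rightarrow> 'a) \<Rightarrow> bool" where
  "Z2_space X \<nu> \<longleftrightarrow>
     continuous_involution X \<nu> \<and>
     (\<exists>(K :: nat set set) \<sigma>. finite_complex K \<and> simplicial_involution K \<sigma> \<and>
        Z2_homotopy_equivalent X \<nu> (geometric_realization K) (realization_map K \<sigma>))"

text \<open>The antipodal map on \<^term>\<open>nsphere d\<close>, the unit sphere in the first \<open>d + 1\<close> coordinates.\<close>

definition antipodal :: "(nat \<Rightarrow> real) \<Rightarrow> nat \<Rightarrow> real" where
  "antipodal x = (\<lambda>i. - x i)"

end

theory Submission
  imports Defs
begin

text \<open>A compact metric \<open>\<int>\<^sub>2\<close>-space \<open>S\<close> has Borsuk graphs: the vertices are a finite net,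
  and two of them are adjacent when each is \<open>\<epsilon>\<close>-close to the image of the other under the
  involution.  For small
  \<open>\<epsilon>\<close>, a \<open>\<int>\<^sub>2\<close>-map from \<open>S\<close> to the \<open>d\<close>-sphere yields a colouring with \<open>d + 2\<close> colours, because
  the sphere is covered by \<open>d + 2\<close> sets none of which contains almost antipodal points.
  Conversely, bump functions supported near the colour classes turn such a colouring of a
  sufficiently dense net into a \<open>\<int>\<^sub>2\<close>-map to the \<open>d\<close>-sphere.  The Borsuk graph of a product is
  the tensor product of the Borsuk graphs, so Hedetniemi's conjecture for these graphs
  carries over to the spaces.\<close>

section \<open>Chromatic number\<close>

lemma graph_hom_complete_graph_mono:
  assumes "graph_hom G (complete_graph m) f" "m \<le> n"
  shows "graph_hom G (complete_graph n) f"
  using assms by (fastforce simp: graph_hom_def complete_graph_def)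

text \<open>Colourability is monotone in the number of colours, and an infimum in
  \<open>enat\<close> below a finite bound is attained.\<close>

lemma chromatic_number_le_iff:
  "chromatic_number G \<le> enat n \<longleftrightarrow> (\<exists>f. graph_hom G (complete_graph n) f)"
proof
  assume le: "chromatic_number G \<le> enat n"
  define N where "N = {n. \<exists>f. graph_hom G (complete_graph n) f}"
  \<comment> \<open>The strict bound lets \<open>Inf_less_iff\<close> produce a member of
    \<open>N\<close>; an empty \<open>N\<close> would have infimum
    \<open>\<infinity>\<close>.\<close>
  have "Inf (enat ` N) < enat (Suc n)"
    using le by (simp add: chromatic_number_def N_def le_less_trans)
  then obtain m where "m \<in> N" "m \<le> n"
    by (auto simp: Inf_less_iff)
  then show "\<exists>f. graph_hom G (complete_graph n) f"
    unfolding N_def by (blast intro: graph_hom_complete_graph_mono)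
next
  assume "\<exists>f. graph_hom G (complete_graph n) f"
  then show "chromatic_number G \<le> enat n"
    unfolding chromatic_number_def by (intro INF_lower) auto
qed

lemma graph_hom_complete_graphI:
  assumes "\<And>u. u \<in> verts G \<Longrightarrow> c u < n"
    and "adj G \<subseteq> verts G \<times> verts G"
    and "\<And>u v. (u, v) \<in> adj G \<Longrightarrow> c u \<noteq> c v"
  shows "graph_hom G (complete_graph n) c"
  using assms by (fastforce simp: graph_hom_def complete_graph_def)

text \<open>The conjecture enters here: a minimum is at most \<open>n\<close> exactly when one of
  its arguments is.\<close>

lemma hedetniemi_colouring:
  fixes G H :: "nat ugraph"
  assumes "hedetniemi_conjecture" "finite_graph G" "finite_graph H"
    and "graph_hom (tensor_product G H) (complete_graph n) c"
  shows "(\<exists>f. graph_hom G (complete_graph n) f) \<or> (\<exists>f. graph_hom H (complete_graph n) f)"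
proof -
  have "chromatic_number (tensor_product G H) \<le> enat n"
    using assms(4) chromatic_number_le_iff by blast
  moreover have "chromatic_number (tensor_product G H)
      = min (chromatic_number G) (chromatic_number H)"
    using assms(1-3) by (simp add: hedetniemi_conjecture_def)
  ultimately show ?thesis
    by (simp add: min_le_iff_disj chromatic_number_le_iff)
qed

section \<open>Maps to the sphere\<close>

text \<open>Reduces equivariant maps to families of real functions. The vanishing beyond
  \<open>d\<close> appears because \<open>nsphere d\<close> lives among all real sequences.\<close>

lemma Z2_map_nsphere_iff:
  "Z2_map (top_of_set S) \<nu> (nsphere d) antipodal f \<longleftrightarrow>
     (\<forall>k. continuous_on S (\<lambda>x. f x k)) \<and>
     (\<forall>x\<in>S. (\<Sum>i\<le>d. (f x i)\<^sup>2) = 1 \<and> (\<forall>i>d. f x i = 0)) \<and>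
     (\<forall>x\<in>S. \<forall>k. f (\<nu> x) k = - f x k)"
proof -
  have "continuous_map (top_of_set S) (powertop_real UNIV) f
      \<longleftrightarrow> (\<forall>k. continuous_on S (\<lambda>x. f x k))"
    by (simp add: continuous_map_componentwise_UNIV)
  then show ?thesis
    by (auto simp: Z2_map_def equivariant_def nsphere continuous_map_in_subtopology
        antipodal_def fun_eq_iff Pi_iff)
qed

lemma Z2_map_compose:
  assumes "Z2_map X \<nu> Y \<mu> f" "Z2_map Y \<mu> Z \<rho> g"
  shows "Z2_map X \<nu> Z \<rho> (g \<circ> f)"
  using assms unfolding Z2_map_def equivariant_def
  by (auto simp: continuous_map_compose dest: continuous_map_funspace)

lemma Z2_map_prod:
  assumes "Z2_map X \<nu> X' \<nu>' f" "Z2_map Y \<mu> Y' \<mu>' g"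
  shows "Z2_map (prod_topology X Y) (map_prod \<nu> \<mu>) (prod_topology X' Y') (map_prod \<nu>' \<mu>') (map_prod f g)"
  using assms unfolding Z2_map_def equivariant_def
  by (auto simp: map_prod_def continuous_map_prod_top)

text \<open>The Euclidean norm of the first \<open>d + 1\<close> coordinates is positive and even
  under \<open>\<nu>\<close>, so dividing by it preserves continuity and oddness.\<close>

lemma Z2_map_nsphere_normalize:
  assumes cont: "\<And>k. continuous_on S (\<lambda>x. w x k)"
    and odd: "\<And>x k. x \<in> S \<Longrightarrow> w (\<nu> x) k = - w x k"
    and nz: "\<And>x. x \<in> S \<Longrightarrow> \<exists>k\<le>d. w x k \<noteq> (0::real)"
  shows "\<exists>f. Z2_map (top_of_set S) \<nu> (nsphere d) antipodal f"
proof -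
  define s where "s x = (\<Sum>i\<le>d. (w x i)\<^sup>2)" for x
  define f where "f x k = (if k \<le> d then w x k / sqrt (s x) else 0)" for x k
  have pos: "s x > 0" if x: "x \<in> S" for x
  proof -
    obtain k where "k \<le> d" "w x k \<noteq> 0"
      using nz[OF x] by blast
    then show ?thesis
      unfolding s_def by (intro sum_pos2[where i = k]) auto
  qed
  have cs: "continuous_on S s"
    unfolding s_def by (intro continuous_intros cont)
  have "continuous_on S (\<lambda>x. f x k)" for k
    unfolding f_def using pos
    by (cases "k \<le> d") (force intro!: continuous_intros cont cs)+
  moreover have "(\<Sum>i\<le>d. (f x i)\<^sup>2) = 1" if "x \<in> S" for x
  proof -
    have "(\<Sum>i\<le>d. (f x i)\<^sup>2) = (\<Sum>i\<le>d. (w x i)\<^sup>2 / s x)"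
      using pos[OF that] by (intro sum.cong) (auto simp: f_def power_divide)
    also have "\<dots> = s x / s x"
      by (simp only: s_def sum_divide_distrib)
    finally show ?thesis
      using pos[OF that] by simp
  qed
  moreover have "f (\<nu> x) k = - f x k" if "x \<in> S" for x k
    using odd[OF that] by (simp add: f_def s_def)
  ultimately have "Z2_map (top_of_set S) \<nu> (nsphere d) antipodal f"
    by (auto simp: Z2_map_nsphere_iff f_def)
  then show ?thesis
    by blast
qed

section \<open>Colouring the sphere with \<open>d + 2\<close> colours\<close>

definition sphere_colour :: "nat \<Rightarrow> real \<Rightarrow> (nat \<Rightarrow> real) \<Rightarrow> nat" where
  "sphere_colour d \<delta> x = (if \<exists>i\<le>d. \<delta> \<le> x i then LEAST i. i \<le> d \<and> \<delta> \<le> x i else Suc d)"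

lemma sphere_colour_props:
  "sphere_colour d \<delta> x \<le> d \<and> \<delta> \<le> x (sphere_colour d \<delta> x) \<or>
   sphere_colour d \<delta> x = Suc d \<and> (\<forall>i\<le>d. x i < \<delta>)"
proof (cases "\<exists>i\<le>d. \<delta> \<le> x i")
  case True
  then have "sphere_colour d \<delta> x \<le> d \<and> \<delta> \<le> x (sphere_colour d \<delta> x)"
    unfolding sphere_colour_def using LeastI_ex[of "\<lambda>i. i \<le> d \<and> \<delta> \<le> x i"] by simp
  then show ?thesis ..
next
  case False
  then show ?thesis
    unfolding sphere_colour_def by (simp add: not_le del: not_ex) (meson not_le)
qed

text \<open>Colours up to \<open>d\<close> mark caps around the positive axes, and a shared one
  forces \<open>x i + y i \<ge> 2 * \<delta>\<close>. If both points have colour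
  \<open>Suc d\<close>, all their coordinates are below \<open>\<delta>\<close>; near-antipodality
  then bounds those of \<open>x\<close> below by \<open>- 2 * \<delta>\<close>, too small for a unit
  vector.\<close>

lemma sphere_colour_neq:
  assumes x: "(\<Sum>i\<le>d. (x i)\<^sup>2) = 1" and near: "\<And>i. i \<le> d \<Longrightarrow> \<bar>x i + y i\<bar> < \<delta>"
    and \<delta>: "real (Suc d) * (2 * \<delta>)\<^sup>2 < 1"
  shows "sphere_colour d \<delta> x \<noteq> sphere_colour d \<delta> y"
proof
  assume eq: "sphere_colour d \<delta> x = sphere_colour d \<delta> y"
  have \<delta>0: "0 < \<delta>"
    using near[of 0] by linarith
  show False
  proof (cases "sphere_colour d \<delta> x \<le> d")
    case True
    then have "\<delta> \<le> x (sphere_colour d \<delta> x)" "\<delta> \<le> y (sphere_colour d \<delta> x)"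
      using sphere_colour_props[of d \<delta> x] sphere_colour_props[of d \<delta> y] eq by auto
    then show False
      using near[OF True] \<delta>0 by linarith
  next
    case False
    have "(x i)\<^sup>2 \<le> (2 * \<delta>)\<^sup>2" if "i \<le> d" for i
    proof -
      have "x i < \<delta>" "y i < \<delta>"
        using False eq that sphere_colour_props[of d \<delta> x] sphere_colour_props[of d \<delta> y] by auto
      then have "\<bar>x i\<bar> \<le> 2 * \<delta>"
        using near[OF that] \<delta>0 by linarith
      then show ?thesis
        using abs_le_square_iff[of "x i" "2 * \<delta>"] \<delta>0 by simp
    qed
    then have "(\<Sum>i\<le>d. (x i)\<^sup>2) \<le> real (card {..d}) * (2 * \<delta>)\<^sup>2"
      by (intro sum_bounded_above) auto
    then show False
      using x \<delta> by simp
  qed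
qed

section \<open>Borsuk graphs\<close>

text \<open>Vertices are indices of net points, so that the conjecture for graphs on
  \<open>nat\<close> applies directly. Both inequalities are demanded because \<open>\<nu>\<close>
  need not be an isometry, and adjacency must be symmetric.\<close>

definition borsuk_graph ::
    "(nat \<Rightarrow> 'a::metric_space) \<Rightarrow> nat \<Rightarrow> ('a \<Rightarrow> 'a) \<Rightarrow> real \<Rightarrow> nat ugraph" where
  "borsuk_graph p m \<nu> \<epsilon> =
     \<lparr>verts = {..<m},
      adj = {(i, j). i < m \<and> j < m \<and> dist (p i) (\<nu> (p j)) < \<epsilon> \<and> dist (p j) (\<nu> (p i)) < \<epsilon>}\<rparr>"

lemma finite_graph_borsuk_graph: "finite_graph (borsuk_graph p m \<nu> \<epsilon>)"
  by (auto simp: finite_graph_def borsuk_graph_def sym_def)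

text \<open>Pulls the colouring of the sphere back along \<open>h\<close>. The scale
  \<open>\<epsilon>\<close> comes from uniform continuity alone and works for all nets, which can
  therefore be chosen afterwards.\<close>

lemma Z2_map_product_imp_colouring:
  fixes S :: "'a::metric_space set" and T :: "'b::metric_space set"
  assumes "compact S" "compact T"
    and \<nu>: "\<nu> ` S \<subseteq> S" and \<mu>: "\<mu> ` T \<subseteq> T"
    and h: "Z2_map (top_of_set (S \<times> T)) (map_prod \<nu> \<mu>) (nsphere d) antipodal h"
  obtains \<epsilon> where "\<epsilon> > 0"
    and "\<And>p q m n. p ` {..<m} \<subseteq> S \<Longrightarrow> q ` {..<n} \<subseteq> T \<Longrightarrow>
      \<exists>c. graph_hom (tensor_product (borsuk_graph p m \<nu> \<epsilon>) (borsuk_graph q n \<mu> \<epsilon>))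
        (complete_graph (d + 2)) c"
proof -
  \<comment> \<open>Chosen so that \<open>(d + 1) * (2 * \<delta>)\<^sup>2\<close> equals
    \<open>(d + 1) / (d + 2)\<^sup>2\<close>, which is below 1.\<close>
  define \<delta> where "\<delta> = 1 / (2 * real (d + 2))"
  have \<delta>0: "\<delta> > 0"
    by (simp add: \<delta>_def)
  have \<delta>: "real (Suc d) * (2 * \<delta>)\<^sup>2 < 1"
  proof -
    have "2 * \<delta> = 1 / real (d + 2)"
      by (simp add: \<delta>_def field_simps)
    then have "real (Suc d) * (2 * \<delta>)\<^sup>2 = real (Suc d) / (real (d + 2))\<^sup>2"
      by (simp add: power_divide)
    also have "\<dots> < 1"
      by (simp add: power2_eq_square algebra_simps add_pos_nonneg)
    finally show ?thesis .
  qed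
  have h': "\<And>k. continuous_on (S \<times> T) (\<lambda>z. h z k)"
    "\<And>z. z \<in> S \<times> T \<Longrightarrow> (\<Sum>i\<le>d. (h z i)\<^sup>2) = 1"
    "\<And>x y k. x \<in> S \<Longrightarrow> y \<in> T \<Longrightarrow> h (\<nu> x, \<mu> y) k = - h (x, y) k"
    using h by (auto simp: Z2_map_nsphere_iff)
  have "\<exists>e>0. \<forall>x\<in>S. \<forall>x'\<in>S. \<forall>y\<in>T. \<forall>y'\<in>T. dist x x' < e \<longrightarrow> dist y y' < e \<longrightarrow>
      dist (h (x, y) k) (h (x', y') k) < \<delta>" for k
    using compact_uniformly_continuous[OF h'(1) compact_Times[OF assms(1,2)], of k] \<delta>0
    unfolding uniformly_continuous_on_prod_metric by blast
  then obtain e where e: "\<And>k. e k > (0::real)"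
    "\<And>k x x' y y'. x \<in> S \<Longrightarrow> x' \<in> S \<Longrightarrow> y \<in> T \<Longrightarrow> y' \<in> T \<Longrightarrow> dist x x' < e k \<Longrightarrow>
      dist y y' < e k \<Longrightarrow> dist (h (x, y) k) (h (x', y') k) < \<delta>"
    by metis
  \<comment> \<open>Only the coordinates up to \<open>d\<close> matter, so a minimum of finitely
    many moduli stays positive.\<close>
  define \<epsilon> where "\<epsilon> = Min (e ` {..d})"
  have \<epsilon>: "\<epsilon> > 0" "\<And>k. k \<le> d \<Longrightarrow> \<epsilon> \<le> e k"
    using e(1) by (auto simp: \<epsilon>_def)
  show thesis
  proof
    show "\<epsilon> > 0" by fact
    fix p :: "nat \<Rightarrow> 'a" and q :: "nat \<Rightarrow> 'b" and m n
    assume p: "p ` {..<m} \<subseteq> S" and q: "q ` {..<n} \<subseteq> T"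
    let ?G = "tensor_product (borsuk_graph p m \<nu> \<epsilon>) (borsuk_graph q n \<mu> \<epsilon>)"
    define c where "c = (\<lambda>(i, j). sphere_colour d \<delta> (h (p i, q j)))"
    have "graph_hom ?G (complete_graph (d + 2)) c"
    proof (rule graph_hom_complete_graphI)
      fix u
      show "c u < d + 2"
        using sphere_colour_props[of d \<delta> "h (p (fst u), q (snd u))"]
        by (auto simp: c_def case_prod_beta)
    next
      show "adj ?G \<subseteq> verts ?G \<times> verts ?G"
        by (auto simp: tensor_product_def borsuk_graph_def)
    next
      fix u v
      assume uv: "(u, v) \<in> adj ?G"
      obtain i j i' j' where ij: "u = (i, j)" "v = (i', j')"
        by (metis surj_pair)
      have in_S: "p i \<in> S" "p i' \<in> S" "\<nu> (p i') \<in> S" "q j \<in> T" "q j' \<in> T" "\<mu> (q j') \<in> T"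
        using uv p q \<nu> \<mu>
        by (auto simp: ij tensor_product_def borsuk_graph_def image_subset_iff)
      have close: "dist (p i) (\<nu> (p i')) < \<epsilon>" "dist (q j) (\<mu> (q j')) < \<epsilon>"
        using uv by (auto simp: ij tensor_product_def borsuk_graph_def)
      \<comment> \<open>By oddness the sum is the difference of \<open>h\<close> at
        \<open>(p i, q j)\<close> and at the image of \<open>(p i', q j')\<close> under the
        involution, two close points.\<close>
      have "\<bar>h (p i, q j) k + h (p i', q j') k\<bar> < \<delta>" if "k \<le> d" for k
        using e(2)[of "p i" "\<nu> (p i')" "q j" "\<mu> (q j')" k] in_S close \<epsilon>(2)[OF that]
        by (simp add: h'(3) dist_real_def)
      then show "c u \<noteq> c v"
        unfolding ij c_def using sphere_colour_neq[OF h'(2) _ \<delta>] in_S by simp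
    qed
    then show "\<exists>c. graph_hom ?G (complete_graph (d + 2)) c"
      by blast
  qed
qed

section \<open>From colourings of nets back to equivariant maps\<close>

lemma compact_finite_net:
  fixes S :: "'a::metric_space set"
  assumes "compact S" "\<eta> > 0"
  obtains p :: "nat \<Rightarrow> 'a" and m
  where "p ` {..<m} \<subseteq> S" "\<And>x. x \<in> S \<Longrightarrow> \<exists>i<m. dist x (p i) < \<eta>"
proof -
  obtain N where N: "finite N" "N \<subseteq> S" "S \<subseteq> (\<Union>x\<in>N. ball x \<eta>)"
    using seq_compact_imp_totally_bounded[OF compact_imp_seq_compact[OF assms(1)],
        rule_format, OF assms(2)] by (elim exE conjE)
  obtain p :: "nat \<Rightarrow> 'a" and m where p: "N = p ` {i. i < m}"
    using finite_imp_nat_seg_image_inj_on[OF N(1)] by (elim exE conjE)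
  show thesis
  proof
    show "p ` {..<m} \<subseteq> S"
      using N p by auto
    show "\<exists>i<m. dist x (p i) < \<eta>" if "x \<in> S" for x
      using N(3) that by (fastforce simp: p dist_commute)
  qed
qed

text \<open>Net points near \<open>x\<close> are adjacent to net points near \<open>\<nu> x\<close>,
  so no colour occurs near both. The difference of bump functions at \<open>x\<close> and
  \<open>\<nu> x\<close> is then an odd, nonconstant vector of \<open>d + 2\<close> entries.\<close>

lemma borsuk_colouring_imp_Z2_map:
  fixes S :: "'a::metric_space set"
  assumes "compact S" and cont: "continuous_on S \<nu>" and \<nu>: "\<nu> ` S \<subseteq> S"
    and inv: "\<And>x. x \<in> S \<Longrightarrow> \<nu> (\<nu> x) = x" and "\<epsilon> > 0"
  obtains p :: "nat \<Rightarrow> 'a" and m where "p ` {..<m} \<subseteq> S"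
    and "\<And>c. graph_hom (borsuk_graph p m \<nu> \<epsilon>) (complete_graph (d + 2)) c \<Longrightarrow>
      \<exists>f. Z2_map (top_of_set S) \<nu> (nsphere d) antipodal f"
proof -
  obtain e where e: "e > 0" "\<And>x x'. x \<in> S \<Longrightarrow> x' \<in> S \<Longrightarrow> dist x' x < e \<Longrightarrow> dist (\<nu> x') (\<nu> x) < \<epsilon> / 2"
    using compact_uniformly_continuous[OF cont assms(1)] \<open>\<epsilon> > 0\<close>
    unfolding uniformly_continuous_on_def by (meson half_gt_zero)
  \<comment> \<open>Two errors of at most \<open>\<epsilon> / 2\<close> must add up: the distance to
    a net point, and the distance after applying \<open>\<nu>\<close>, controlled by
    \<open>e\<close>.\<close>
  define \<eta> where "\<eta> = min e (\<epsilon> / 2)"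
  have \<eta>: "\<eta> > 0" "\<eta> \<le> e" "\<eta> \<le> \<epsilon> / 2"
    using e(1) \<open>\<epsilon> > 0\<close> by (auto simp: \<eta>_def)
  obtain p :: "nat \<Rightarrow> 'a" and m where p: "p ` {..<m} \<subseteq> S"
    and net: "\<And>x. x \<in> S \<Longrightarrow> \<exists>i<m. dist x (p i) < \<eta>"
    using compact_finite_net[OF assms(1) \<eta>(1)] by metis
  show thesis
  proof
    show "p ` {..<m} \<subseteq> S" by fact
    fix c
    assume c: "graph_hom (borsuk_graph p m \<nu> \<epsilon>) (complete_graph (d + 2)) c"
    have c_less: "c i < d + 2" if "i < m" for i
      using c that by (force simp: graph_hom_def complete_graph_def borsuk_graph_def)
    \<comment> \<open>Applying \<open>\<nu>\<close> to the closeness of \<open>\<nu> x\<close> and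
      \<open>p j\<close> places \<open>x\<close> itself near \<open>\<nu> (p j)\<close>.\<close>
    have close_step: "dist (p i) (\<nu> (p j)) < \<epsilon>"
      if "x \<in> S" "i < m" "j < m" "dist x (p i) < \<eta>" "dist (\<nu> x) (p j) < \<eta>" for x i j
    proof -
      have "dist (\<nu> (\<nu> x)) (\<nu> (p j)) < \<epsilon> / 2"
        using that p \<nu> \<eta> by (intro e(2)) auto
      then have "dist x (\<nu> (p j)) < \<epsilon> / 2"
        using inv that by simp
      then show ?thesis
        using dist_triangle_half_r[of x] that(4) \<eta>(3) by fastforce
    qed
    have c_neq: "c i \<noteq> c j"
      if "x \<in> S" "i < m" "j < m" "dist x (p i) < \<eta>" "dist (\<nu> x) (p j) < \<eta>" for x i j
    proof -
      \<comment> \<open>The same estimate at \<open>\<nu> x\<close> with \<open>i\<close> and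
        \<open>j\<close> exchanged.\<close>
      have "dist (p j) (\<nu> (p i)) < \<epsilon>"
        using close_step[of "\<nu> x" j i] that \<nu> inv by auto
      then have "(i, j) \<in> adj (borsuk_graph p m \<nu> \<epsilon>)"
        using close_step[OF that] that by (auto simp: borsuk_graph_def)
      then show ?thesis
        using c by (fastforce simp: graph_hom_def complete_graph_def)
    qed
    \<comment> \<open>A continuous substitute for the statement that colour \<open>k\<close> occurs
      near \<open>x\<close>.\<close>
    define b where "b k x = (\<Sum>i\<in>{i. i < m \<and> c i = k}. max 0 (\<eta> - dist x (p i)))" for k x
    have b_cont: "continuous_on S (b k)" for k
      unfolding b_def by (intro continuous_intros)
    have b_pos: "b k x > 0 \<longleftrightarrow> (\<exists>i<m. c i = k \<and> dist x (p i) < \<eta>)" for k x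
    proof
      assume "\<exists>i<m. c i = k \<and> dist x (p i) < \<eta>"
      then obtain i where "i < m" "c i = k" "dist x (p i) < \<eta>" by blast
      then show "b k x > 0"
        unfolding b_def by (intro sum_pos2[where i = i]) auto
    next
      assume "b k x > 0"
      then show "\<exists>i<m. c i = k \<and> dist x (p i) < \<eta>"
        unfolding b_def by (rule contrapos_pp) (auto simp: not_less intro!: sum_nonpos)
    qed
    txt \<open>\<open>v x\<close> has a positive and a negative entry, so it stays nonzero modulo constant vectors;
      this quotient drops the dimension from \<open>d + 2\<close> to \<open>d + 1\<close>.\<close>
    define v where "v x k = b k x - b k (\<nu> x)" for x k
    define w where "w x k = v x k - v x (Suc d)" for x k
    have v_pos: "\<exists>k<d + 2. v x k > 0" if x: "x \<in> S" for x
    proof -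
      obtain i where i: "i < m" "dist x (p i) < \<eta>"
        using net[OF x] by blast
      \<comment> \<open>The colour of a net point near \<open>x\<close> cannot occur near
        \<open>\<nu> x\<close>.\<close>
      have "\<not> b (c i) (\<nu> x) > 0"
        using b_pos c_neq[OF x i(1) _ i(2)] by metis
      moreover have "b (c i) x > 0"
        using b_pos i by blast
      ultimately have "v x (c i) > 0"
        by (simp add: v_def)
      then show ?thesis
        using c_less[OF i(1)] by blast
    qed
    have v_odd: "v (\<nu> x) k = - v x k" if "x \<in> S" for x k
      using inv[OF that] by (simp add: v_def)
    show "\<exists>f. Z2_map (top_of_set S) \<nu> (nsphere d) antipodal f"
    proof (rule Z2_map_nsphere_normalize)
      have "continuous_on S (\<lambda>x. b k (\<nu> x))" for k
        using continuous_on_compose2[OF b_cont cont \<nu>] .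
      then show "continuous_on S (\<lambda>x. w x k)" for k
        unfolding w_def v_def by (intro continuous_intros b_cont)
      show "w (\<nu> x) k = - w x k" if "x \<in> S" for x k
        by (simp add: w_def v_odd[OF that])
      show "\<exists>k\<le>d. w x k \<noteq> 0" if x: "x \<in> S" for x
      proof (rule ccontr)
        assume "\<not> ?thesis"
        then have const: "v x k = v x (Suc d)" if "k < d + 2" for k
          using that by (cases "k = Suc d") (auto simp: w_def)
        \<comment> \<open>A positive entry at \<open>\<nu> x\<close> is a negative entry at
          \<open>x\<close> by oddness, so \<open>v x\<close> cannot be constant.\<close>
        obtain k l where kl: "k < d + 2" "v x k > 0" "l < d + 2" "v (\<nu> x) l > 0"
          using v_pos[OF x] v_pos[of "\<nu> x"] x \<nu> by blast
        have "v x k = v x l"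
          using const[OF kl(1)] const[OF kl(3)] by (metis (full_types))
        then show False
          using kl v_odd[OF x] by simp
      qed
    qed
  qed
qed

text \<open>First \<open>\<epsilon>\<close> is fixed by \<open>h\<close>, then a net of each space
  is chosen for it; the conjecture passes the colouring of the product graph to one of the
  factors.\<close>

lemma compact_hedetniemi:
  fixes S :: "'a::metric_space set" and T :: "'b::metric_space set"
  assumes "hedetniemi_conjecture"
    and S: "compact S" "continuous_on S \<nu>" "\<nu> ` S \<subseteq> S" "\<And>x. x \<in> S \<Longrightarrow> \<nu> (\<nu> x) = x"
    and T: "compact T" "continuous_on T \<mu>" "\<mu> ` T \<subseteq> T" "\<And>y. y \<in> T \<Longrightarrow> \<mu> (\<mu> y) = y"
    and h: "Z2_map (top_of_set (S \<times> T)) (map_prod \<nu> \<mu>) (nsphere d) antipodal h"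
  shows "(\<exists>f. Z2_map (top_of_set S) \<nu> (nsphere d) antipodal f) \<or>
         (\<exists>f. Z2_map (top_of_set T) \<mu> (nsphere d) antipodal f)"
proof -
  obtain \<epsilon> where \<epsilon>: "\<epsilon> > 0"
    and col: "\<And>p q m n. p ` {..<m} \<subseteq> S \<Longrightarrow> q ` {..<n} \<subseteq> T \<Longrightarrow>
      \<exists>c. graph_hom (tensor_product (borsuk_graph p m \<nu> \<epsilon>) (borsuk_graph q n \<mu> \<epsilon>))
        (complete_graph (d + 2)) c"
    using Z2_map_product_imp_colouring[OF S(1) T(1) S(3) T(3) h] by blast
  obtain p :: "nat \<Rightarrow> 'a" and m where p: "p ` {..<m} \<subseteq> S"
    "\<And>c. graph_hom (borsuk_graph p m \<nu> \<epsilon>) (complete_graph (d + 2)) c \<Longrightarrow>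
      \<exists>f. Z2_map (top_of_set S) \<nu> (nsphere d) antipodal f"
    using borsuk_colouring_imp_Z2_map[OF S \<epsilon>] by blast
  obtain q :: "nat \<Rightarrow> 'b" and n where q: "q ` {..<n} \<subseteq> T"
    "\<And>c. graph_hom (borsuk_graph q n \<mu> \<epsilon>) (complete_graph (d + 2)) c \<Longrightarrow>
      \<exists>f. Z2_map (top_of_set T) \<mu> (nsphere d) antipodal f"
    using borsuk_colouring_imp_Z2_map[OF T \<epsilon>] by blast
  show ?thesis
    using hedetniemi_colouring[OF assms(1) finite_graph_borsuk_graph finite_graph_borsuk_graph]
      col[OF p(1) q(1)] p(2) q(2) by blast
qed

section \<open>Geometric realizations\<close>

definition realization_set :: "'v set set \<Rightarrow> ('v \<Rightarrow> real) set" where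
  "realization_set K = {t. (\<forall>v. 0 \<le> t v) \<and> {v. t v \<noteq> 0} \<in> K \<and> (\<Sum>v \<in> \<Union>K. t v) = 1}"

lemma geometric_realization_eq: "geometric_realization K = top_of_set (realization_set K)"
  by (simp add: geometric_realization_def realization_set_def euclidean_product_topology)

text \<open>The realization is a closed subset of a cube, which is compact by Tychonoff.\<close>

lemma compact_realization_set:
  assumes K: "finite_complex K"
  shows "compact (realization_set K)"
proof -
  define V where "V = \<Union>K"
  have fin: "finite V"
    using K by (auto simp: finite_complex_def V_def)
  define C where "C = (\<Pi>\<^sub>E v\<in>(UNIV::'a set). {0..1::real})"
  have "compactin (powertop_real UNIV) C"
    unfolding C_def by (subst compactin_PiE) auto
  then have "compact C"
    by (simp add: euclidean_product_topology)
  moreover have "closed {t :: 'a \<Rightarrow> real. (\<Sum>v \<in> V. t v) = 1}"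
    by (intro closed_Collect_eq continuous_on_sum continuous_on_product_coordinates
        continuous_on_const)
  \<comment> \<open>Closed form of the support condition: vanishing outside a fixed simplex is
    closed, and there are finitely many simplices.\<close>
  moreover have "closed (\<Union>A\<in>K. {t :: 'a \<Rightarrow> real. \<forall>v\<in>-A. t v = 0})"
  proof (rule closed_UN)
    show "finite K"
      using K by (simp add: finite_complex_def)
    show "\<forall>A\<in>K. closed {t :: 'a \<Rightarrow> real. \<forall>v\<in>-A. t v = 0}"
      unfolding Ball_def
      by (intro allI impI closed_Collect_all closed_Collect_imp open_Collect_const closed_Collect_eq
          continuous_on_product_coordinates continuous_on_const)
  qed
  ultimately have "compact (C \<inter> {t. (\<Sum>v \<in> V. t v) = 1} \<inter> (\<Union>A\<in>K. {t. \<forall>v\<in>-A. t v = 0}))"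
    by (intro compact_Int_closed)
  also have "C \<inter> {t. (\<Sum>v \<in> V. t v) = 1} \<inter> (\<Union>A\<in>K. {t. \<forall>v\<in>-A. t v = 0}) = realization_set K"
  proof (intro set_eqI iffI)
    fix t
    assume t: "t \<in> C \<inter> {t. (\<Sum>v \<in> V. t v) = 1} \<inter> (\<Union>A\<in>K. {t. \<forall>v\<in>-A. t v = 0})"
    then obtain A where A: "A \<in> K" "\<forall>v\<in>-A. t v = 0" by blast
    \<comment> \<open>Total weight 1 makes the support nonempty, hence a face of \<open>A\<close>
      and a member of \<open>K\<close>.\<close>
    have "(\<Sum>v \<in> V. t v) \<noteq> 0"
      using t by simp
    then have "{v. t v \<noteq> 0} \<noteq> {}"
      by (metis (mono_tags, lifting) empty_Collect_eq sum.neutral)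
    moreover have "{v. t v \<noteq> 0} \<subseteq> A"
      using A(2) by auto
    ultimately have "{v. t v \<noteq> 0} \<in> K"
      using K A(1) unfolding finite_complex_def by blast
    then show "t \<in> realization_set K"
      using t by (auto simp: realization_set_def C_def V_def PiE_UNIV_domain)
  next
    fix t
    assume t: "t \<in> realization_set K"
    have le: "t v \<le> 1" for v
    proof (cases "v \<in> V")
      case True
      then have "t v \<le> (\<Sum>v \<in> V. t v)"
        using t fin by (intro member_le_sum) (auto simp: realization_set_def)
      then show ?thesis
        using t by (simp add: realization_set_def V_def)
    next
      case False
      then have "t v = 0"
        using t by (auto simp: realization_set_def V_def)
      then show ?thesis by simp
    qed
    then show "t \<in> C \<inter> {t. (\<Sum>v \<in> V. t v) = 1} \<inter> (\<Union>A\<in>K. {t. \<forall>v\<in>-A. t v = 0})"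
      using t by (auto simp: realization_set_def C_def V_def PiE_UNIV_domain
          intro!: bexI[of _ "{v. t v \<noteq> 0}"])
  qed
  finally show ?thesis .
qed

section \<open>The involution on a realization\<close>

lemma simplicial_involution_vertex:
  assumes "simplicial_involution K \<sigma>" "v \<in> \<Union>K"
  shows "\<sigma> v \<in> \<Union>K" "\<sigma> (\<sigma> v) = v"
  using assms by (auto simp: simplicial_involution_def)

text \<open>As \<open>\<sigma>\<close> is its own inverse on vertices, each fibre over a vertex is a
  single vertex and other fibres are empty, so pushing weights forward is precomposition with
  \<open>\<sigma>\<close>.\<close>

lemma realization_map_eq:
  assumes \<sigma>: "simplicial_involution K \<sigma>"
  shows "realization_map K \<sigma> t w = (if w \<in> \<Union>K then t (\<sigma> w) else 0)"
proof (cases "w \<in> \<Union>K")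
  case True
  then have "v \<in> \<Union>K \<and> \<sigma> v = w \<longleftrightarrow> v = \<sigma> w" for v
    using simplicial_involution_vertex[OF \<sigma>] by metis
  then have "{v \<in> \<Union>K. \<sigma> v = w} = {\<sigma> w}"
    by (simp only: singleton_conv)
  then show ?thesis
    using True by (simp add: realization_map_def del: Union_iff)
next
  case False
  then have "\<not> (v \<in> \<Union>K \<and> \<sigma> v = w)" for v
    using simplicial_involution_vertex[OF \<sigma>] by metis
  then have "{v \<in> \<Union>K. \<sigma> v = w} = {}"
    by (simp only: Collect_empty_eq) blast
  then show ?thesis
    using False unfolding realization_map_def by (simp only: sum.empty if_False)
qed

text \<open>The support is moved by \<open>\<sigma>\<close> to another simplex, and the total weight
  is only reindexed.\<close>

lemma realization_map_in_set:
  assumes \<sigma>: "simplicial_involution K \<sigma>" and t: "t \<in> realization_set K"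
  shows "realization_map K \<sigma> t \<in> realization_set K"
proof -
  note sv = simplicial_involution_vertex[OF \<sigma>]
  have supp: "{v. t v \<noteq> 0} \<in> K"
    using t by (simp add: realization_set_def)
  then have V: "v \<in> \<Union>K" if "t v \<noteq> 0" for v
    using that by blast
  have "{w. realization_map K \<sigma> t w \<noteq> 0} = \<sigma> ` {v. t v \<noteq> 0}"
  proof (intro set_eqI iffI)
    fix w
    assume "w \<in> {w. realization_map K \<sigma> t w \<noteq> 0}"
    then have "w \<in> \<Union>K" "t (\<sigma> w) \<noteq> 0"
      by (auto simp: realization_map_eq[OF \<sigma>] simp del: Union_iff split: if_splits)
    then show "w \<in> \<sigma> ` {v. t v \<noteq> 0}"
      using sv(2) by (intro image_eqI[of _ _ "\<sigma> w"]) auto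
  next
    fix w
    assume "w \<in> \<sigma> ` {v. t v \<noteq> 0}"
    then obtain v where v: "w = \<sigma> v" "t v \<noteq> 0" by blast
    then show "w \<in> {w. realization_map K \<sigma> t w \<noteq> 0}"
      using sv[OF V[OF v(2)]] by (simp add: realization_map_eq[OF \<sigma>] del: Union_iff)
  qed
  then have "{w. realization_map K \<sigma> t w \<noteq> 0} \<in> K"
    using \<sigma> supp by (simp add: simplicial_involution_def)
  moreover have "(\<Sum>w\<in>\<Union>K. realization_map K \<sigma> t w) = (\<Sum>w\<in>\<Union>K. t w)"
    by (rule sum.reindex_bij_witness[where i = \<sigma> and j = \<sigma>])
      (use sv in \<open>auto simp: realization_map_eq[OF \<sigma>] simp del: Union_iff\<close>)
  ultimately show ?thesis
    using t by (simp add: realization_set_def realization_map_eq[OF \<sigma>] del: Union_iff)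
qed

lemma realization_map_involution:
  assumes \<sigma>: "simplicial_involution K \<sigma>" and t: "t \<in> realization_set K"
  shows "realization_map K \<sigma> (realization_map K \<sigma> t) = t"
proof
  fix w
  have "t w = 0" if "w \<notin> \<Union>K"
    using t that by (auto simp: realization_set_def)
  then show "realization_map K \<sigma> (realization_map K \<sigma> t) w = t w"
    using simplicial_involution_vertex[OF \<sigma>]
    by (simp add: realization_map_eq[OF \<sigma>] del: Union_iff)
qed

lemma continuous_on_realization_map: "continuous_on S (realization_map K \<sigma>)"
  unfolding realization_map_def
  by (intro continuous_on_coordinatewise_then_product continuous_on_sum
      continuous_on_subset[OF continuous_on_product_coordinates]) auto

text \<open>Supplies a compact model inside \<open>nat \<Rightarrow> real\<close>, a metric space,
  with equivariant maps both ways for moving maps to the sphere between \<open>X\<close> and the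
  model.\<close>

lemma Z2_spaceE:
  assumes "Z2_space X \<nu>"
  obtains S :: "(nat \<Rightarrow> real) set" and \<mu> f g
  where "compact S" "continuous_on S \<mu>" "\<mu> ` S \<subseteq> S" "\<And>x. x \<in> S \<Longrightarrow> \<mu> (\<mu> x) = x"
    and "Z2_map X \<nu> (top_of_set S) \<mu> f" "Z2_map (top_of_set S) \<mu> X \<nu> g"
proof -
  obtain K :: "nat set set" and \<sigma> f g
    where K: "finite_complex K" and \<sigma>: "simplicial_involution K \<sigma>"
      and f: "Z2_map X \<nu> (geometric_realization K) (realization_map K \<sigma>) f"
      and g: "Z2_map (geometric_realization K) (realization_map K \<sigma>) X \<nu> g"
    using assms unfolding Z2_space_def Z2_homotopy_equivalent_def by blast
  show thesis
  proof (rule that)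
    show "compact (realization_set K)"
      by (rule compact_realization_set[OF K])
    show "continuous_on (realization_set K) (realization_map K \<sigma>)"
      by (rule continuous_on_realization_map)
    show "realization_map K \<sigma> ` realization_set K \<subseteq> realization_set K"
      using realization_map_in_set[OF \<sigma>] by blast
    show "realization_map K \<sigma> (realization_map K \<sigma> t) = t" if "t \<in> realization_set K" for t
      by (rule realization_map_involution[OF \<sigma> that])
  qed (use f g in \<open>simp_all add: geometric_realization_eq\<close>)
qed

theorem theorem1p4:
  fixes X :: "'a topology" and \<nu>X :: "'a \<Rightarrow> 'a"
    and Y :: "'b topology" and \<nu>Y :: "'b \<Rightarrow> 'b"
    and d :: nat
  assumes "hedetniemi_conjecture"
    and "Z2_space X \<nu>X" and "Z2_space Y \<nu>Y"
    and "\<exists>f. Z2_map (prod_topology X Y) (map_prod \<nu>X \<nu>Y) (nsphere d) antipodal f"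
  shows "(\<exists>f. Z2_map X \<nu>X (nsphere d) antipodal f) \<or>
         (\<exists>f. Z2_map Y \<nu>Y (nsphere d) antipodal f)"
proof -
  obtain S :: "(nat \<Rightarrow> real) set" and \<nu> f g
    where S: "compact S" "continuous_on S \<nu>" "\<nu> ` S \<subseteq> S" "\<And>x. x \<in> S \<Longrightarrow> \<nu> (\<nu> x) = x"
      and f: "Z2_map X \<nu>X (top_of_set S) \<nu> f" and g: "Z2_map (top_of_set S) \<nu> X \<nu>X g"
    using Z2_spaceE[OF assms(2)] by blast
  obtain T :: "(nat \<Rightarrow> real) set" and \<mu> f' g'
    where T: "compact T" "continuous_on T \<mu>" "\<mu> ` T \<subseteq> T" "\<And>x. x \<in> T \<Longrightarrow> \<mu> (\<mu> x) = x"
      and f': "Z2_map Y \<nu>Y (top_of_set T) \<mu> f'" and g': "Z2_map (top_of_set T) \<mu> Y \<nu>Y g'"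
    using Z2_spaceE[OF assms(3)] by blast
  obtain h where h: "Z2_map (prod_topology X Y) (map_prod \<nu>X \<nu>Y) (nsphere d) antipodal h"
    using assms(4) by blast
  \<comment> \<open>Pull \<open>h\<close> back to the compact models along \<open>g\<close> and
    \<open>g'\<close>; the resulting map on one model returns along \<open>f\<close> or
    \<open>f'\<close>.\<close>
  have "Z2_map (top_of_set (S \<times> T)) (map_prod \<nu> \<mu>) (nsphere d) antipodal (h \<circ> map_prod g g')"
    using Z2_map_compose[OF Z2_map_prod[OF g g'] h] by simp
  from compact_hedetniemi[OF assms(1) S T this] show ?thesis
    using Z2_map_compose[OF f] Z2_map_compose[OF f'] by blast
qed

end
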